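(* Let $V$ be a Hilbert space with a localizing space decomposition with local spaces $V_1,\dots,V_N$. Let $a$ be a continuous, symmetric and coercive form on $V$, let $V$ be equipped with the energy norm $\|\cdot\|_a$, let $f\in V'$, and let $u\in V$ solve $a(u,v)=f(v)$ for all $v\in V$. Construct $\widetilde V_n$ and $\widetilde u_n$ by globally coupled online enrichment: $\widetilde V_0:=\{0\}$; for $n=0,1,2,\dots$ let $\widetilde u_n\in\widetilde V_n$ solve $a(\widetilde u_n,\varphi)=f(\varphi)$ for all $\varphi\in\widetilde V_n$; for each $i=1,\dots,N$ let $\widehat u_{n,i}\in\widetilde V_n+V_i$ solve $a(\widehat u_{n,i},\varphi)=f(\varphi)$ for all $\varphi\in\widetilde V_n+V_i$; choose $k\in\operatorname{arg\,max}_{i=1,\dots,N}\|\widetilde u_n-\widehat u_{n,i}\|_a$; and set $\widetilde V_{n+1}:=\widetilde V_n+\operatorname{span}\{\widehat u_{n,k}\}$. Then for every $n$, $$\|u-\widetilde u_{n+1}\|_a=\min_{i=1,\dots,N}\;\min_{\psi_e\in V_i}\Big\{\|u-\widetilde u_e\|_a\;\Big|\;\widetilde u_e\in\widetilde V_n+\operatorname{span}\{\psi_e\}\text{ solves }a(\widetilde u_e,\varphi)=f(\varphi)\ \ \forall\varphi\in\widetilde V_n+\operatorname{span}\{\psi_e\}\Big\} .$$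
   Context: A localizing space decomposition consists of: an open, bounded, connected domain $\Omega\subset\mathbb{R}^d$ with smooth boundary; a Hilbert space $V$ of functions on $\Omega$ (over $\mathbb{R}$ or $\mathbb{C}$); subdomains $\omega_1,\dots,\omega_N$ forming an overlapping or non-overlapping domain decomposition of $\Omega$; (closed) subspaces $V_1,\dots,V_N\subseteq V$ with $\sum_i V_i=V$ and $\operatorname{supp}\varphi\subseteq\omega_i$ for all $\varphi\in V_i$; and linear maps $\mathcal{P}_{V_i}:V\to V_i$ with $\sum_i\mathcal{P}_{V_i}(\varphi)=\varphi$ for all $\varphi\in V$. The form $a$ is bilinear, symmetric (in the complex case sesquilinear, Hermitian), and $\|\varphi\|_a^2=a(\varphi,\varphi)$. *)

theory Defs
  imports "HOL-Analysis.Analysis" "HOL-Library.Set_Algebras"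
begin

text \<open>
  Scalar fields: the class captures \<^typ>\<open>real\<close> and \<^typ>\<open>complex\<close> uniformly. The value
  \<open>rc_re x\<close> is the real part and \<open>rc_cnj x\<close> the complex conjugate, which is the identity on
  \<^typ>\<open>real\<close>.
\<close>

class rc_scalar = real_normed_field +
  fixes rc_cnj :: "'a \<Rightarrow> 'a" and rc_re :: "'a \<Rightarrow> real"
  assumes rc_cnj_add: "rc_cnj (x + y) = rc_cnj x + rc_cnj y"
    and rc_cnj_mult: "rc_cnj (x * y) = rc_cnj x * rc_cnj y"
    and rc_cnj_cnj: "rc_cnj (rc_cnj x) = x"
    and rc_mult_cnj: "x * rc_cnj x = ((norm x)\<^sup>2) *\<^sub>R 1"
    and rc_add_cnj: "x + rc_cnj x = (2 * rc_re x) *\<^sub>R 1"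

instantiation real :: rc_scalar
begin
definition rc_cnj_real :: "real \<Rightarrow> real" where "rc_cnj_real x = x"
definition rc_re_real :: "real \<Rightarrow> real" where "rc_re_real x = x"
instance
  by standard (simp_all add: rc_cnj_real_def rc_re_real_def power2_eq_square)
end

instantiation complex :: rc_scalar
begin
definition rc_cnj_complex :: "complex \<Rightarrow> complex" where "rc_cnj_complex x = cnj x"
definition rc_re_complex :: "complex \<Rightarrow> real" where "rc_re_complex x = Re x"
instance
proof
  fix x y :: complex
  show "rc_cnj (x + y) = rc_cnj x + rc_cnj y" "rc_cnj (x * y) = rc_cnj x * rc_cnj y"
    "rc_cnj (rc_cnj x) = x"
    by (simp_all add: rc_cnj_complex_def)
  show "x * rc_cnj x = ((norm x)\<^sup>2) *\<^sub>R 1"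
    unfolding rc_cnj_complex_def scaleR_conv_of_real mult_1_right by (rule complex_norm_square [symmetric])
  show "x + rc_cnj x = (2 * rc_re x) *\<^sub>R 1"
    unfolding rc_cnj_complex_def rc_re_complex_def scaleR_conv_of_real mult_1_right
    by (rule complex_add_cnj)
qed
end

text \<open>
  Function spaces such as \<open>L\<^sup>2\<close> or \<open>H\<^sup>1\<close> consist of functions up to equality almost everywhere.
  A function on \<open>\<Omega>\<close> is represented by its extension by zero, i.e. by a class that
  vanishes almost everywhere outside \<open>\<Omega>\<close>.
\<close>

definition ae_eq :: "(real^'d \<Rightarrow> 'k) \<Rightarrow> (real^'d \<Rightarrow> 'k) \<Rightarrow> bool"
  where "ae_eq f g \<longleftrightarrow> (AE x in lebesgue. f x = g x)"

quotient_type (overloaded) ('d, 'k) aefun = "real^('d::finite) \<Rightarrow> 'k" / ae_eq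
proof (rule equivpI)
  show "reflp ae_eq"
    by (simp add: reflp_def ae_eq_def)
  show "symp ae_eq"
    by (simp add: symp_def ae_eq_def eq_commute)
  show "transp ae_eq"
    unfolding transp_def ae_eq_def
    by (intro allI impI, erule (1) eventually_elim2, simp)
qed

instantiation aefun :: (finite, ab_group_add) ab_group_add
begin

lift_definition zero_aefun :: "('a, 'b) aefun" is "\<lambda>x. 0" .

lift_definition plus_aefun :: "('a, 'b) aefun \<Rightarrow> ('a, 'b) aefun \<Rightarrow> ('a, 'b) aefun"
  is "\<lambda>f g x. f x + g x"
  by (simp only: ae_eq_def, erule (1) eventually_elim2, simp)

lift_definition minus_aefun :: "('a, 'b) aefun \<Rightarrow> ('a, 'b) aefun \<Rightarrow> ('a, 'b) aefun"
  is "\<lambda>f g x. f x - g x"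
  by (simp only: ae_eq_def, erule (1) eventually_elim2, simp)

lift_definition uminus_aefun :: "('a, 'b) aefun \<Rightarrow> ('a, 'b) aefun"
  is "\<lambda>f x. - f x"
  by (simp only: ae_eq_def, erule eventually_mono, simp)

instance
  by standard (transfer; simp add: ae_eq_def algebra_simps)+

end

lift_definition ae_scale :: "'k::rc_scalar \<Rightarrow> ('d::finite, 'k) aefun \<Rightarrow> ('d, 'k) aefun"
  is "\<lambda>c f x. c * f x"
  by (simp only: ae_eq_def, erule eventually_mono, simp)

interpretation ae: vector_space ae_scale
  by standard (transfer; simp add: ae_eq_def algebra_simps)+

lift_definition vanishes_ae_on :: "(real^('d::finite)) set \<Rightarrow> ('d, 'k::zero) aefun \<Rightarrow> bool"
  is "\<lambda>S f. AE x in lebesgue. x \<in> S \<longrightarrow> f x = 0"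
  by (simp only: ae_eq_def, intro iffI; erule (1) eventually_elim2, simp)

definition ae_support :: "('d::finite, 'k::zero) aefun \<Rightarrow> (real^'d) set"
  where "ae_support \<phi> = {x. \<forall>U. open U \<and> x \<in> U \<longrightarrow> \<not> vanishes_ae_on U \<phi>}"

primrec Ck_on :: "nat \<Rightarrow> ('a::euclidean_space \<Rightarrow> real) \<Rightarrow> 'a set \<Rightarrow> bool" where
  "Ck_on 0 f U \<longleftrightarrow> continuous_on U f"
| "Ck_on (Suc k) f U \<longleftrightarrow>
     f differentiable_on U \<and> (\<forall>b\<in>Basis. Ck_on k (\<lambda>x. frechet_derivative f (at x) b) U)"

text \<open>Smooth boundary: locally \<open>\<Omega>\<close> is a sublevel set of a smooth function without critical points.\<close>

definition smooth_boundary :: "'a::euclidean_space set \<Rightarrow> bool" where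
  "smooth_boundary \<Omega> \<longleftrightarrow>
     (\<forall>p \<in> frontier \<Omega>. \<exists>U \<rho>. open U \<and> p \<in> U \<and> (\<forall>k. Ck_on k \<rho> U) \<and>
        (\<forall>x\<in>U. frechet_derivative \<rho> (at x) \<noteq> (\<lambda>_. 0)) \<and>
        \<rho> p = 0 \<and> \<Omega> \<inter> U = {x \<in> U. \<rho> x < 0})"

text \<open>
  Sesquilinear forms are conjugate-linear in the first and linear in the second argument, so that
  \<open>a(u,\<cdot>)\<close> is a linear functional. Over \<^typ>\<open>real\<close> they are the bilinear forms.
\<close>

definition sesquilinear_on ::
    "('d::finite, 'k::rc_scalar) aefun set \<Rightarrow> (('d, 'k) aefun \<Rightarrow> ('d, 'k) aefun \<Rightarrow> 'k) \<Rightarrow> bool" where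
  "sesquilinear_on V a \<longleftrightarrow>
     (\<forall>x\<in>V. \<forall>y\<in>V. \<forall>z\<in>V. a (x + y) z = a x z + a y z \<and> a z (x + y) = a z x + a z y) \<and>
     (\<forall>c. \<forall>x\<in>V. \<forall>y\<in>V. a (ae_scale c x) y = rc_cnj c * a x y \<and> a x (ae_scale c y) = c * a x y)"

definition hermitian_on ::
    "('d::finite, 'k::rc_scalar) aefun set \<Rightarrow> (('d, 'k) aefun \<Rightarrow> ('d, 'k) aefun \<Rightarrow> 'k) \<Rightarrow> bool" where
  "hermitian_on V a \<longleftrightarrow> (\<forall>x\<in>V. \<forall>y\<in>V. a y x = rc_cnj (a x y))"

text \<open>Taking the real part only changes the type: \<open>a x x\<close> is real for Hermitian \<open>a\<close>.\<close>

definition form_norm ::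
    "(('d::finite, 'k::rc_scalar) aefun \<Rightarrow> ('d, 'k) aefun \<Rightarrow> 'k) \<Rightarrow> ('d, 'k) aefun \<Rightarrow> real" where
  "form_norm a x = sqrt (rc_re (a x x))"

definition inner_product_on ::
    "('d::finite, 'k::rc_scalar) aefun set \<Rightarrow> (('d, 'k) aefun \<Rightarrow> ('d, 'k) aefun \<Rightarrow> 'k) \<Rightarrow> bool" where
  "inner_product_on V ip \<longleftrightarrow>
     sesquilinear_on V ip \<and> hermitian_on V ip \<and> (\<forall>x\<in>V. x \<noteq> 0 \<longrightarrow> 0 < rc_re (ip x x))"

definition hilbert_space_on ::
    "('d::finite, 'k::rc_scalar) aefun set \<Rightarrow> (('d, 'k) aefun \<Rightarrow> ('d, 'k) aefun \<Rightarrow> 'k) \<Rightarrow> bool" where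
  "hilbert_space_on V ip \<longleftrightarrow>
     ae.subspace V \<and> inner_product_on V ip \<and>
     (\<forall>X. (\<forall>n. X n \<in> V) \<and>
          (\<forall>e>0. \<exists>M. \<forall>m\<ge>M. \<forall>n\<ge>M. form_norm ip (X m - X n) < e) \<longrightarrow>
        (\<exists>x\<in>V. (\<lambda>n::nat. form_norm ip (X n - x)) \<longlonglongrightarrow> 0))"

definition closed_subspace_of ::
    "('d::finite, 'k::rc_scalar) aefun set \<Rightarrow> (('d, 'k) aefun \<Rightarrow> ('d, 'k) aefun \<Rightarrow> 'k) \<Rightarrow>
     ('d, 'k) aefun set \<Rightarrow> bool" where
  "closed_subspace_of V ip W \<longleftrightarrow>
     ae.subspace W \<and> W \<subseteq> V \<and>
     (\<forall>X. \<forall>x\<in>V. (\<forall>n::nat. X n \<in> W) \<and> (\<lambda>n. form_norm ip (X n - x)) \<longlonglongrightarrow> 0 \<longrightarrow> x \<in> W)"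

definition continuous_form ::
    "('d::finite, 'k::rc_scalar) aefun set \<Rightarrow> (('d, 'k) aefun \<Rightarrow> ('d, 'k) aefun \<Rightarrow> 'k) \<Rightarrow>
     (('d, 'k) aefun \<Rightarrow> ('d, 'k) aefun \<Rightarrow> 'k) \<Rightarrow> bool" where
  "continuous_form V ip a \<longleftrightarrow>
     (\<exists>C. \<forall>x\<in>V. \<forall>y\<in>V. norm (a x y) \<le> C * form_norm ip x * form_norm ip y)"

definition coercive_form ::
    "('d::finite, 'k::rc_scalar) aefun set \<Rightarrow> (('d, 'k) aefun \<Rightarrow> ('d, 'k) aefun \<Rightarrow> 'k) \<Rightarrow>
     (('d, 'k) aefun \<Rightarrow> ('d, 'k) aefun \<Rightarrow> 'k) \<Rightarrow> bool" where
  "coercive_form V ip a \<longleftrightarrow>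
     (\<exists>\<alpha>>0. \<forall>x\<in>V. \<alpha> * (form_norm ip x)\<^sup>2 \<le> rc_re (a x x))"

text \<open>Only the values of \<open>f\<close> on \<open>V\<close> matter.\<close>

definition dual_on ::
    "('d::finite, 'k::rc_scalar) aefun set \<Rightarrow> (('d, 'k) aefun \<Rightarrow> ('d, 'k) aefun \<Rightarrow> 'k) \<Rightarrow>
     (('d, 'k) aefun \<Rightarrow> 'k) \<Rightarrow> bool" where
  "dual_on V ip f \<longleftrightarrow>
     (\<forall>x\<in>V. \<forall>y\<in>V. f (x + y) = f x + f y) \<and>
     (\<forall>c. \<forall>x\<in>V. f (ae_scale c x) = c * f x) \<and>
     (\<exists>C. \<forall>x\<in>V. norm (f x) \<le> C * form_norm ip x)"

definition linear_map_into ::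
    "('d::finite, 'k::rc_scalar) aefun set \<Rightarrow> ('d, 'k) aefun set \<Rightarrow>
     (('d, 'k) aefun \<Rightarrow> ('d, 'k) aefun) \<Rightarrow> bool" where
  "linear_map_into V W T \<longleftrightarrow>
     (\<forall>x\<in>V. T x \<in> W) \<and>
     (\<forall>x\<in>V. \<forall>y\<in>V. T (x + y) = T x + T y) \<and>
     (\<forall>c. \<forall>x\<in>V. T (ae_scale c x) = ae_scale c (T x))"

text \<open>The two alternatives are the overlapping and the non-overlapping decompositions.\<close>

definition domain_decomposition :: "'a::topological_space set \<Rightarrow> nat \<Rightarrow> (nat \<Rightarrow> 'a set) \<Rightarrow> bool" where
  "domain_decomposition \<Omega> N \<omega> \<longleftrightarrow>
     (\<forall>i\<in>{1..N}. open (\<omega> i) \<and> \<omega> i \<noteq> {} \<and> \<omega> i \<subseteq> \<Omega>) \<and>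
     ((\<Union>i\<in>{1..N}. \<omega> i) = \<Omega> \<or>
      disjoint_family_on \<omega> {1..N} \<and> (\<Union>i\<in>{1..N}. closure (\<omega> i)) = closure \<Omega>)"

text \<open>
  The support of a class is a closed set, so being supported in the open subdomain \<open>\<omega> i\<close> is
  to be read with the closure of \<open>\<omega> i\<close>; otherwise \<open>H\<^sub>0\<^sup>1(\<omega> i)\<close> would be excluded as a local space.
\<close>

definition localizing_decomposition ::
    "(real^('d::finite)) set \<Rightarrow> ('d, 'k::rc_scalar) aefun set \<Rightarrow>
     (('d, 'k) aefun \<Rightarrow> ('d, 'k) aefun \<Rightarrow> 'k) \<Rightarrow> nat \<Rightarrow> (nat \<Rightarrow> (real^'d) set) \<Rightarrow>
     (nat \<Rightarrow> ('d, 'k) aefun set) \<Rightarrow> (nat \<Rightarrow> ('d, 'k) aefun \<Rightarrow> ('d, 'k) aefun) \<Rightarrow> bool" where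
  "localizing_decomposition \<Omega> V ip N \<omega> Vloc P \<longleftrightarrow>
     open \<Omega> \<and> bounded \<Omega> \<and> connected \<Omega> \<and> \<Omega> \<noteq> {} \<and> smooth_boundary \<Omega> \<and>
     hilbert_space_on V ip \<and> (\<forall>\<phi>\<in>V. vanishes_ae_on (- \<Omega>) \<phi>) \<and>
     domain_decomposition \<Omega> N \<omega> \<and>
     (\<forall>i\<in>{1..N}. closed_subspace_of V ip (Vloc i) \<and>
                  (\<forall>\<phi>\<in>Vloc i. ae_support \<phi> \<subseteq> closure (\<omega> i))) \<and>
     (\<Sum>i\<in>{1..N}. Vloc i) = V \<and>
     (\<forall>i\<in>{1..N}. linear_map_into V (Vloc i) (P i)) \<and>
     (\<forall>\<phi>\<in>V. (\<Sum>i\<in>{1..N}. P i \<phi>) = \<phi>)"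

definition variational_solution ::
    "(('d::finite, 'k::rc_scalar) aefun \<Rightarrow> ('d, 'k) aefun \<Rightarrow> 'k) \<Rightarrow> (('d, 'k) aefun \<Rightarrow> 'k) \<Rightarrow>
     ('d, 'k) aefun set \<Rightarrow> ('d, 'k) aefun \<Rightarrow> bool" where
  "variational_solution a f W w \<longleftrightarrow> w \<in> W \<and> (\<forall>\<phi>\<in>W. a w \<phi> = f \<phi>)"

text \<open>
  A run of globally coupled online enrichment: \<open>Vt n\<close> and \<open>ut n\<close> are the reduced spaces and
  solutions, \<open>uh n i\<close> the locally enriched solutions, and \<open>k n\<close> is the (not necessarily unique)
  maximizing index chosen in step \<open>n\<close>. Sums of spaces are elementwise.
\<close>

definition online_enrichment ::
    "(('d::finite, 'k::rc_scalar) aefun \<Rightarrow> ('d, 'k) aefun \<Rightarrow> 'k) \<Rightarrow> (('d, 'k) aefun \<Rightarrow> 'k) \<Rightarrow>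
     nat \<Rightarrow> (nat \<Rightarrow> ('d, 'k) aefun set) \<Rightarrow>
     (nat \<Rightarrow> ('d, 'k) aefun set) \<Rightarrow> (nat \<Rightarrow> ('d, 'k) aefun) \<Rightarrow>
     (nat \<Rightarrow> nat \<Rightarrow> ('d, 'k) aefun) \<Rightarrow> (nat \<Rightarrow> nat) \<Rightarrow> bool" where
  "online_enrichment a f N Vloc Vt ut uh k \<longleftrightarrow>
     Vt 0 = {0} \<and>
     (\<forall>n. variational_solution a f (Vt n) (ut n) \<and>
          (\<forall>i\<in>{1..N}. variational_solution a f (Vt n + Vloc i) (uh n i)) \<and>
          is_arg_max (\<lambda>i. form_norm a (ut n - uh n i)) (\<lambda>i. i \<in> {1..N}) (k n) \<and>
          Vt (Suc n) = Vt n + ae.span {uh n (k n)})"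

definition is_minimum :: "'a::order set \<Rightarrow> 'a \<Rightarrow> bool" where
  "is_minimum S m \<longleftrightarrow> m \<in> S \<and> (\<forall>s\<in>S. m \<le> s)"

end

theory Submission
  imports Defs
begin

text \<open>
  Write \<open>u\<^sub>W\<close> for the solution of the variational problem in a subspace \<open>W \<subseteq> V\<close>. The error
  \<open>u - u\<^sub>W\<close> is \<open>a\<close>-orthogonal to \<open>W\<close> (Galerkin orthogonality), so by Pythagoras
  \<open>\<parallel>u - v\<parallel>\<^sup>2 = \<parallel>u - u\<^sub>W\<parallel>\<^sup>2 + \<parallel>v - u\<^sub>W\<parallel>\<^sup>2\<close> for all \<open>v \<in> W\<close>
  (\<open>galerkin_pythagoras\<close>); in particular \<open>u\<^sub>W\<close> is the best approximation of \<open>u\<close> in \<open>W\<close>.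

  Fix \<open>n\<close> and \<open>i\<close> and decompose \<open>uh n i = w + \<psi>\<close> with \<open>w \<in> Vt n\<close> and \<open>\<psi> \<in> Vloc i\<close>.
  The space \<open>Vt n + span {\<psi>}\<close> contains \<open>uh n i\<close> and lies in \<open>Vt n + Vloc i\<close>, hence
  \<open>uh n i\<close> is also the solution in this smaller space. Conversely, every space
  \<open>Vt n + span {\<psi>'}\<close> with \<open>\<psi>' \<in> Vloc i\<close> lies in \<open>Vt n + Vloc i\<close>, where \<open>uh n i\<close> is
  optimal. The inner minimum is therefore \<open>\<parallel>u - uh n i\<parallel>\<close> (\<open>local_enrichment_minimum\<close>).

  By Pythagoras in \<open>Vt n + Vloc i\<close>, the number
  \<open>\<parallel>u - uh n i\<parallel>\<^sup>2 + \<parallel>ut n - uh n i\<parallel>\<^sup>2 = \<parallel>u - ut n\<parallel>\<^sup>2\<close> does not depend on \<open>i\<close>, so the index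
  \<open>k n\<close> that maximizes the update \<open>\<parallel>ut n - uh n i\<parallel>\<close> minimizes the error
  \<open>\<parallel>u - uh n i\<parallel>\<close>. Finally, \<open>Vt (n + 1) \<subseteq> Vt n + Vloc (k n)\<close> contains
  \<open>uh n (k n)\<close>. Each of \<open>ut (n + 1)\<close> and \<open>uh n (k n)\<close> is thus at least as good an
  approximation as the other, and their errors agree.
\<close>

lemma rc_re_unique:
  fixes x :: "'k::rc_scalar"
  assumes "x + rc_cnj x = (2 * r) *\<^sub>R 1"
  shows "rc_re x = r"
  using assms rc_add_cnj[of x] by simp

lemma rc_re_add: "rc_re (x + y) = rc_re x + rc_re (y :: 'k::rc_scalar)"
proof (rule rc_re_unique)
  have "(x + y) + rc_cnj (x + y) = (x + rc_cnj x) + (y + rc_cnj y)"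
    by (simp add: rc_cnj_add)
  also have "\<dots> = (2 * (rc_re x + rc_re y)) *\<^sub>R 1"
    by (simp only: rc_add_cnj scaleR_left_distrib distrib_left)
  finally show "(x + y) + rc_cnj (x + y) = (2 * (rc_re x + rc_re y)) *\<^sub>R 1" .
qed

lemma rc_cnj_zero: "rc_cnj (0 :: 'k::rc_scalar) = 0"
  using rc_cnj_add[of "0 :: 'k" 0] by simp

lemma form_add_orthogonal:
  assumes "sesquilinear_on V a" "hermitian_on V a" "ae.subspace V"
    and "x \<in> V" "y \<in> V" "a x y = 0"
  shows "rc_re (a (x + y) (x + y)) = rc_re (a x x) + rc_re (a y y)"
proof -
  have "a y x = 0"
    using assms(2,4-6) rc_cnj_zero unfolding hermitian_on_def by metis
  moreover have "x + y \<in> V"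
    using assms by (simp add: ae.subspace_add)
  ultimately have "a (x + y) (x + y) = a x x + a y y"
    using assms(1,4-6) by (simp add: sesquilinear_on_def)
  then show ?thesis
    by (simp add: rc_re_add)
qed

lemma form_diff_left:
  assumes "sesquilinear_on V a" "ae.subspace V" "x \<in> V" "y \<in> V" "z \<in> V"
  shows "a (x - y) z = a x z - a y z"
proof -
  have "x - y \<in> V"
    using assms by (simp add: ae.subspace_diff)
  then have "a ((x - y) + y) z = a (x - y) z + a y z"
    using assms unfolding sesquilinear_on_def by blast
  then show ?thesis
    by simp
qed

lemma subspace_set_plus:
  assumes "ae.subspace A" "ae.subspace B"
  shows "ae.subspace (A + B)"
proof -
  have "A + B = {x + y | x y. x \<in> A \<and> y \<in> B}"
    by (auto simp: set_plus_def)
  then show ?thesis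
    using ae.subspace_sums[OF assms] by simp
qed

lemma set_plus_subset_subspace:
  assumes "ae.subspace V" "A \<subseteq> V" "B \<subseteq> V"
  shows "A + B \<subseteq> V"
  using assms by (auto simp: set_plus_def intro: ae.subspace_add)

lemma subset_set_plus_subspace: "ae.subspace B \<Longrightarrow> A \<subseteq> A + B"
  using set_zero_plus2[of B A] by (simp add: ae.subspace_0 add.commute)

lemma galerkin_pythagoras:
  assumes a: "sesquilinear_on V a" "hermitian_on V a" "ae.subspace V"
    and nonneg: "\<And>x. x \<in> V \<Longrightarrow> 0 \<le> rc_re (a x x)"
    and W: "ae.subspace W" "W \<subseteq> V"
    and u: "variational_solution a f V u"
    and w: "variational_solution a f W w"
    and v: "v \<in> W"
  shows "(form_norm a (u - v))\<^sup>2 = (form_norm a (u - w))\<^sup>2 + (form_norm a (v - w))\<^sup>2"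
proof -
  have in_V: "u \<in> V" "w \<in> V" "v \<in> V" and "w \<in> W"
    using u w v W by (auto simp: variational_solution_def)
  then have wv: "w - v \<in> W" "w - v \<in> V" and uw: "u - w \<in> V" and vw: "v - w \<in> V"
    using v W a by (auto intro: ae.subspace_diff)
  have uv: "u - v \<in> V"
    using in_V a by (auto intro: ae.subspace_diff)
  have "a (u - w) (w - v) = a u (w - v) - a w (w - v)"
    using a in_V wv by (auto intro: form_diff_left)
  also have "\<dots> = 0"
    using u w wv by (simp add: variational_solution_def)
  finally have orth: "a (u - w) (w - v) = 0" .
  have "a (v - w) (v - w) = a (w - v) (w - v)"
  proof -
    have minus: "v - w = ae_scale (- 1) (w - v)"
      by (simp add: ae.scale_minus_left)
    have "rc_cnj (- 1 :: 'b) * (- 1) = 1"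
      using rc_mult_cnj[of "- 1 :: 'b"] by (simp add: mult.commute)
    moreover have "a (ae_scale (- 1) (w - v)) (ae_scale (- 1) (w - v))
        = rc_cnj (- 1) * (- 1) * a (w - v) (w - v)"
      using a wv ae.subspace_scale[OF a(3) wv(2)]
      by (simp add: sesquilinear_on_def del: ae.scale_minus_left ae.scale_one)
    ultimately show ?thesis
      unfolding minus by simp
  qed
  moreover have "rc_re (a (u - v) (u - v))
      = rc_re (a (u - w) (u - w)) + rc_re (a (w - v) (w - v))"
    using form_add_orthogonal[OF a uw wv(2) orth] by simp
  ultimately show ?thesis
    using nonneg[OF uw] nonneg[OF vw] nonneg[OF uv] by (simp add: form_norm_def)
qed

lemma galerkin_best_approximation:
  assumes "sesquilinear_on V a" "hermitian_on V a" "ae.subspace V"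
    and nonneg: "\<And>x. x \<in> V \<Longrightarrow> 0 \<le> rc_re (a x x)"
    and W: "ae.subspace W" "W \<subseteq> V"
    and u: "variational_solution a f V u"
    and "variational_solution a f W w"
    and "v \<in> W"
  shows "form_norm a (u - w) \<le> form_norm a (u - v)"
proof (rule power2_le_imp_le)
  show "(form_norm a (u - w))\<^sup>2 \<le> (form_norm a (u - v))\<^sup>2"
    using galerkin_pythagoras[OF assms] by simp
  have "u - v \<in> V"
    using assms by (auto simp: variational_solution_def intro: ae.subspace_diff)
  then show "0 \<le> form_norm a (u - v)"
    using nonneg by (simp add: form_norm_def)
qed

lemma variational_solution_subset:
  assumes "variational_solution a f W w" "W' \<subseteq> W" "w \<in> W'"
  shows "variational_solution a f W' w"
  using assms by (auto simp: variational_solution_def)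

lemma set_plus_span_subset:
  assumes "ae.subspace B" "\<psi> \<in> B"
  shows "A + ae.span {\<psi>} \<subseteq> A + B"
  using assms by (intro set_plus_mono2) (auto intro: ae.span_minimal[THEN subsetD])

text \<open>
  Enriching \<open>W\<close> by a single, optimally chosen element of \<open>L\<close> reduces the error as much as
  enriching it by all of \<open>L\<close>; the optimal element is the \<open>L\<close>-part of the solution in \<open>W + L\<close>.
\<close>

lemma local_enrichment_minimum:
  assumes a: "sesquilinear_on V a" "hermitian_on V a" "ae.subspace V"
    and nonneg: "\<And>x. x \<in> V \<Longrightarrow> 0 \<le> rc_re (a x x)"
    and W: "ae.subspace W" "W \<subseteq> V"
    and L: "ae.subspace L" "L \<subseteq> V"
    and u: "variational_solution a f V u"
    and w: "variational_solution a f (W + L) w"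
  shows "is_minimum {form_norm a (u - v) | v \<psi>. \<psi> \<in> L \<and>
           variational_solution a f (W + ae.span {\<psi>}) v} (form_norm a (u - w))"
proof -
  have "w \<in> W + L"
    using w by (simp add: variational_solution_def)
  then obtain y \<psi> where y: "y \<in> W" and \<psi>: "\<psi> \<in> L" and "w = y + \<psi>"
    by (auto elim: set_plus_elim)
  then have "w \<in> W + ae.span {\<psi>}"
    by (auto intro: ae.span_base)
  then have "variational_solution a f (W + ae.span {\<psi>}) w"
    by (rule variational_solution_subset[OF w set_plus_span_subset[OF L(1) \<psi>]])
  moreover have "form_norm a (u - w) \<le> form_norm a (u - v)"
    if "\<psi>' \<in> L" "variational_solution a f (W + ae.span {\<psi>'}) v" for v \<psi>'
  proof (rule galerkin_best_approximation[OF a nonneg _ _ u w])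
    show "ae.subspace (W + L)" "W + L \<subseteq> V"
      using W L a(3) by (simp_all add: subspace_set_plus set_plus_subset_subspace)
    show "v \<in> W + L"
      using that set_plus_span_subset[OF L(1) that(1)] by (auto simp: variational_solution_def)
  qed
  ultimately show ?thesis
    using \<psi> unfolding is_minimum_def by blast
qed

theorem theorem6p3p3:
  fixes \<Omega> :: "(real^'d::finite) set"
    and V :: "('d, 'k::rc_scalar) aefun set"
    and ip a :: "('d, 'k) aefun \<Rightarrow> ('d, 'k) aefun \<Rightarrow> 'k"
    and N :: nat
    and \<omega> :: "nat \<Rightarrow> (real^'d) set"
    and Vloc :: "nat \<Rightarrow> ('d, 'k) aefun set"
    and P :: "nat \<Rightarrow> ('d, 'k) aefun \<Rightarrow> ('d, 'k) aefun"
    and f :: "('d, 'k) aefun \<Rightarrow> 'k"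
    and u :: "('d, 'k) aefun"
    and Vt :: "nat \<Rightarrow> ('d, 'k) aefun set"
    and ut :: "nat \<Rightarrow> ('d, 'k) aefun"
    and uh :: "nat \<Rightarrow> nat \<Rightarrow> ('d, 'k) aefun"
    and k :: "nat \<Rightarrow> nat"
    and n :: nat
  assumes "localizing_decomposition \<Omega> V ip N \<omega> Vloc P"
    and "sesquilinear_on V a" and "hermitian_on V a"
    and "continuous_form V ip a" and "coercive_form V ip a"
    and "dual_on V ip f"
    and "variational_solution a f V u"
    and "online_enrichment a f N Vloc Vt ut uh k"
  shows "\<exists>m. (\<forall>i\<in>{1..N}. is_minimum
                 {form_norm a (u - ue) | ue \<psi>. \<psi> \<in> Vloc i \<and>
                    variational_solution a f (Vt n + ae.span {\<psi>}) ue} (m i)) \<and>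
             is_minimum (m ` {1..N}) (form_norm a (u - ut (Suc n)))"
proof -
  have V: "ae.subspace V"
    and Vloc: "\<And>i. i \<in> {1..N} \<Longrightarrow> ae.subspace (Vloc i)" "\<And>i. i \<in> {1..N} \<Longrightarrow> Vloc i \<subseteq> V"
    using assms(1)
    by (simp_all add: localizing_decomposition_def hilbert_space_on_def closed_subspace_of_def)
  note a = assms(2,3) V
  note u = assms(7)
  obtain \<alpha> where \<alpha>: "\<alpha> > 0" "\<And>x. x \<in> V \<Longrightarrow> \<alpha> * (form_norm ip x)\<^sup>2 \<le> rc_re (a x x)"
    using assms(5) by (auto simp: coercive_form_def)
  have nonneg: "0 \<le> rc_re (a x x)" if "x \<in> V" for x
    using \<alpha>(2)[OF that] \<alpha>(1) by (meson mult_nonneg_nonneg less_imp_le order_trans zero_le_power2)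
  have Vt_0: "Vt 0 = {0}"
    and ut: "\<And>n. variational_solution a f (Vt n) (ut n)"
    and uh: "\<And>n i. i \<in> {1..N} \<Longrightarrow> variational_solution a f (Vt n + Vloc i) (uh n i)"
    and k: "\<And>n. is_arg_max (\<lambda>i. form_norm a (ut n - uh n i)) (\<lambda>i. i \<in> {1..N}) (k n)"
    and Vt_Suc: "\<And>n. Vt (Suc n) = Vt n + ae.span {uh n (k n)}"
    using assms(8) by (simp_all add: online_enrichment_def)
  have k_in: "k n \<in> {1..N}" for n
    using k[of n] by (simp add: is_arg_max_def)

  have Vt: "ae.subspace (Vt n) \<and> Vt n \<subseteq> V" for n
  proof (induction n)
    case 0
    show ?case
      using V by (simp add: Vt_0 ae.subspace_0)
  next
    case (Suc n)
    have "Vt n + Vloc (k n) \<subseteq> V"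
      using Suc Vloc k_in V by (intro set_plus_subset_subspace) auto
    then have "uh n (k n) \<in> V"
      using uh[OF k_in] by (auto simp: variational_solution_def)
    then have "ae.span {uh n (k n)} \<subseteq> V"
      using V by (intro ae.span_minimal) auto
    then show ?case
      using Suc V by (simp add: Vt_Suc subspace_set_plus set_plus_subset_subspace)
  qed
  have enriched: "ae.subspace (Vt n + Vloc i)" "Vt n + Vloc i \<subseteq> V" if "i \<in> {1..N}" for i
    using Vt Vloc that V by (simp_all add: subspace_set_plus set_plus_subset_subspace)
  have Vt_enriched: "Vt n \<subseteq> Vt n + Vloc i" if "i \<in> {1..N}" for i
    using Vloc(1)[OF that] by (rule subset_set_plus_subspace)

  define m where "m = (\<lambda>i. form_norm a (u - uh n i))"
  have "is_minimum {form_norm a (u - ue) | ue \<psi>. \<psi> \<in> Vloc i \<and>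
          variational_solution a f (Vt n + ae.span {\<psi>}) ue} (m i)" if "i \<in> {1..N}" for i
    unfolding m_def
    using Vt Vloc that uh by (intro local_enrichment_minimum[OF a nonneg _ _ _ _ u]) auto
  moreover have "m (k n) \<le> m i" if i: "i \<in> {1..N}" for i
  proof -
    have split: "(form_norm a (u - ut n))\<^sup>2 = (m j)\<^sup>2 + (form_norm a (ut n - uh n j))\<^sup>2"
      if "j \<in> {1..N}" for j
      unfolding m_def using ut[of n] Vt_enriched[OF that]
      by (intro galerkin_pythagoras[OF a nonneg enriched[OF that] u uh[OF that]])
        (auto simp: variational_solution_def)
    have pos: "0 \<le> form_norm a (w - uh n j)" if "w \<in> V" "j \<in> {1..N}" for w j
    proof -
      have "uh n j \<in> V"
        using uh[OF that(2), of n] enriched[OF that(2)] by (auto simp: variational_solution_def)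
      then show ?thesis
        using nonneg V that by (simp add: form_norm_def ae.subspace_diff)
    qed
    have "ut n \<in> V" and "u \<in> V"
      using ut[of n] Vt u by (auto simp: variational_solution_def)
    have "form_norm a (ut n - uh n i) \<le> form_norm a (ut n - uh n (k n))"
      using k[of n] i by (auto simp: is_arg_max_linorder)
    then have "(form_norm a (ut n - uh n i))\<^sup>2 \<le> (form_norm a (ut n - uh n (k n)))\<^sup>2"
      using pos[OF \<open>ut n \<in> V\<close> i] by (rule power_mono)
    then have "(m (k n))\<^sup>2 \<le> (m i)\<^sup>2"
      using split[OF i] split[OF k_in[of n]] by linarith
    then show ?thesis
      using pos[OF \<open>u \<in> V\<close> i] unfolding m_def by (rule power2_le_imp_le)
  qed
  moreover have "form_norm a (u - ut (Suc n)) = m (k n)"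
  proof -
    let ?w = "uh n (k n)"
    have w: "?w \<in> Vt n + Vloc (k n)"
      using uh[OF k_in] by (simp add: variational_solution_def)
    have "ae.span {?w} \<subseteq> Vt n + Vloc (k n)"
      using w enriched[OF k_in] by (intro ae.span_minimal) auto
    then have sub: "Vt (Suc n) \<subseteq> Vt n + Vloc (k n)"
      unfolding Vt_Suc using Vt_enriched[OF k_in] enriched(1)[OF k_in]
      by (intro set_plus_subset_subspace)
    have "0 + ?w \<in> Vt (Suc n)"
      unfolding Vt_Suc using Vt by (intro set_plus_intro ae.span_base) (auto intro: ae.subspace_0)
    then have mem: "?w \<in> Vt (Suc n)"
      by simp
    have "m (k n) \<le> form_norm a (u - ut (Suc n))"
      unfolding m_def using ut[of "Suc n"] sub
      by (intro galerkin_best_approximation[OF a nonneg enriched[OF k_in] u uh[OF k_in]])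
        (auto simp: variational_solution_def)
    moreover have "form_norm a (u - ut (Suc n)) \<le> m (k n)"
      unfolding m_def using Vt mem
      by (intro galerkin_best_approximation[OF a nonneg _ _ u ut]) auto
    ultimately show ?thesis
      by simp
  qed
  ultimately show ?thesis
    using k_in[of n] unfolding is_minimum_def by (intro exI[of _ m]) auto
qed

end
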